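(* For every $n\in\mathbb N$ there exists a probabilistic online monotone embedding (which may depend on $n$) of up to $n$ points from the real line into HSTs with distortion $O(\log n)$.
   Context: The real line carries the metric $|u-v|$. For $\mu\ge1$, a $\mu$-HST is the metric on the leaves of a rooted tree with node weights $\varphi\ge0$ ($\varphi(v)=0$ iff $v$ is a leaf, $\varphi(v)\le\varphi(u)/\mu$ when $v$ is a child of $u$), leaf distance $\varphi(\mathrm{lca}(u,v))$; "HSTs" is the family of such metrics. An update sequence is a sequence $(v_t,o_t)\in\mathbb R\times\{+,-\}$ ($v_t$ arrives if $o_t=+$, leaves if $o_t=-$) with alive sets $L_0=\varnothing$, $L_t=L_{t-1}\cup\{v_t\}$ or $L_{t-1}\setminus\{v_t\}$. A deterministic online monotone embedding outputs after $\sigma_t$ (depending only on $\sigma_1,\dots,\sigma_t$) an HST metric $d_t$ on $L_t$ with $d_t(u,v)\ge|u-v|$ on $L_t$ and $d_t(u,v)\le d_{t-1}(u,v)$ on $L_{t-1}\cap L_t$; a probabilistic one is a distribution over these (sequence fixed independently of the randomness), with distortion $\lambda$ if $\mathbb E[d_t(u,v)]\le\lambda|u-v|$ for all sequences with at most $n$ points, all $t$ and $u,v\in L_t$. *)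

theory Defs
  imports "HOL-Probability.Probability"
begin

definition tree_ancestors :: "(nat \<Rightarrow> nat) \<Rightarrow> nat \<Rightarrow> nat set" where
  "tree_ancestors p w = {(p ^^ k) w | k. True}"

definition tree_leaf :: "nat set \<Rightarrow> nat \<Rightarrow> (nat \<Rightarrow> nat) \<Rightarrow> nat \<Rightarrow> bool" where
  "tree_leaf V r p w \<longleftrightarrow> w \<in> V \<and> \<not> (\<exists>c \<in> V - {r}. p c = w)"

definition rooted_tree :: "nat set \<Rightarrow> nat \<Rightarrow> (nat \<Rightarrow> nat) \<Rightarrow> bool" where
  "rooted_tree V r p \<longleftrightarrow> finite V \<and> r \<in> V \<and> p r = r \<and> (\<forall>w \<in> V. p w \<in> V)
     \<and> (\<forall>w \<in> V. \<exists>k. (p ^^ k) w = r)"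

text \<open>A mu-HST metric on a finite set S of reals: leaves of a weighted rooted tree are
  identified bijectively with S, leaf distance is the weight of the least common ancestor.\<close>

definition is_mu_HST_metric :: "real \<Rightarrow> real set \<Rightarrow> (real \<Rightarrow> real \<Rightarrow> real) \<Rightarrow> bool" where
  "is_mu_HST_metric \<mu> S d \<longleftrightarrow> S = {} \<or>
    (\<exists>(V::nat set) (r::nat) (p::nat \<Rightarrow> nat) (\<phi>::nat \<Rightarrow> real) (lf::real \<Rightarrow> nat).
       rooted_tree V r p
     \<and> (\<forall>w \<in> V. \<phi> w \<ge> 0)
     \<and> (\<forall>w \<in> V. \<phi> w = 0 \<longleftrightarrow> tree_leaf V r p w)
     \<and> (\<forall>w \<in> V - {r}. \<phi> w \<le> \<phi> (p w) / \<mu>)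
     \<and> bij_betw lf S {w. tree_leaf V r p w}
     \<and> (\<forall>u \<in> S. \<forall>v \<in> S. \<exists>w.
          w \<in> tree_ancestors p (lf u) \<inter> tree_ancestors p (lf v)
        \<and> tree_ancestors p (lf u) \<inter> tree_ancestors p (lf v) \<subseteq> tree_ancestors p w
        \<and> d u v = \<phi> w))"

definition is_HST_metric :: "real set \<Rightarrow> (real \<Rightarrow> real \<Rightarrow> real) \<Rightarrow> bool" where
  "is_HST_metric S d \<longleftrightarrow> (\<exists>\<mu> \<ge> 1. is_mu_HST_metric \<mu> S d)"

type_synonym update_seq = "(real \<times> bool) list"

fun update_step :: "real set \<Rightarrow> real \<times> bool \<Rightarrow> real set" where
  "update_step L (v, True) = insert v L"
| "update_step L (v, False) = L - {v}"

definition alive :: "update_seq \<Rightarrow> real set" where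
  "alive \<sigma> = foldl update_step {} \<sigma>"

definition num_points :: "update_seq \<Rightarrow> nat" where
  "num_points \<sigma> = card (set (map fst \<sigma>))"

text \<open>A deterministic online embedding maps each prefix sigma_1..sigma_t to the metric d_t;
  being a function of the prefix makes it online. It is required to be a valid monotone
  HST embedding on all update sequences with at most n points.\<close>

type_synonym online_embedding = "update_seq \<Rightarrow> real \<Rightarrow> real \<Rightarrow> real"

definition online_monotone_HST_embedding :: "nat \<Rightarrow> online_embedding \<Rightarrow> bool" where
  "online_monotone_HST_embedding n E \<longleftrightarrow>
     (\<forall>\<sigma>. num_points \<sigma> \<le> n \<longrightarrow>
        is_HST_metric (alive \<sigma>) (E \<sigma>)
      \<and> (\<forall>u \<in> alive \<sigma>. \<forall>v \<in> alive \<sigma>. E \<sigma> u v \<ge> \<bar>u - v\<bar>)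
      \<and> (\<forall>x. num_points (\<sigma> @ [x]) \<le> n \<longrightarrow>
           (\<forall>u \<in> alive \<sigma> \<inter> alive (\<sigma> @ [x]). \<forall>v \<in> alive \<sigma> \<inter> alive (\<sigma> @ [x]).
              E (\<sigma> @ [x]) u v \<le> E \<sigma> u v)))"

definition prob_online_monotone_HST_embedding ::
  "nat \<Rightarrow> online_embedding measure \<Rightarrow> bool" where
  "prob_online_monotone_HST_embedding n M \<longleftrightarrow>
     prob_space M \<and> (AE E in M. online_monotone_HST_embedding n E)"

definition has_distortion :: "nat \<Rightarrow> online_embedding measure \<Rightarrow> real \<Rightarrow> bool" where
  "has_distortion n M lam \<longleftrightarrow>
     (\<forall>\<sigma>. num_points \<sigma> \<le> n \<longrightarrow> (\<forall>u \<in> alive \<sigma>. \<forall>v \<in> alive \<sigma>.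
        integrable M (\<lambda>E. E \<sigma> u v) \<and> (\<integral>E. E \<sigma> u v \<partial>M) \<le> lam * \<bar>u - v\<bar>))"

end

theory Submission
  imports Defs
begin

text \<open>At every scale \<open>2^i\<close> each cell of a grid anchored at the first point carries two cuts, with
  independent uniform offsets \<open>a\<close> and \<open>b\<close>; the distance of two points is \<open>4 * 2^i\<close> for the largest
  scale \<open>i\<close> at which a cut separates them. This dominates the line metric, but all scales above
  \<open>\<bar>u - v\<bar>\<close> contribute equally to the expected distance. To leave only \<open>O(log n)\<close> of them, a cut is
  deleted once it lies between two points at distance at most \<open>2^i / n^2\<close>, unless its partner was
  deleted earlier. Deletions only decrease distances, and as one cut of each pair is always kept,
  domination is preserved. For \<open>2^i \<ge> n^2 * \<bar>u - v\<bar>\<close>, a kept cut between \<open>u\<close> and \<open>v\<close> forces the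
  independent partner into one of at most \<open>n^2\<close> short intervals, and these probabilities
  decay geometrically in \<open>i\<close>, summing to \<open>O(1)\<close>.\<close>

section \<open>Finite ultrametrics are HST metrics\<close>

text \<open>In an ultrametric the closed balls of a fixed radius partition the space, and these
  partitions coarsen as the radius grows. Running through the attained distances in increasing order
  gives the tree: one level per distance value, one node per ball, with the radius as weight.
  Weights increase strictly towards the root, so \<open>\<mu> = 1\<close> works.\<close>

lemma ultrametric_is_HST_metric:
  fixes d :: "real \<Rightarrow> real \<Rightarrow> real"
  assumes fin: "finite S"
    and zero: "\<And>u v. u \<in> S \<Longrightarrow> v \<in> S \<Longrightarrow> d u v = 0 \<longleftrightarrow> u = v"
    and sym: "\<And>u v. u \<in> S \<Longrightarrow> v \<in> S \<Longrightarrow> d u v = d v u"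
    and nonneg: "\<And>u v. u \<in> S \<Longrightarrow> v \<in> S \<Longrightarrow> 0 \<le> d u v"
    and ultra: "\<And>u v w. u \<in> S \<Longrightarrow> v \<in> S \<Longrightarrow> w \<in> S \<Longrightarrow> d u w \<le> max (d u v) (d v w)"
  shows "is_HST_metric S d"
proof (cases "S = {}")
  case True
  then show ?thesis unfolding is_HST_metric_def is_mu_HST_metric_def by auto
next
  case False
  define D where "D = (\<lambda>(u, v). d u v) ` (S \<times> S)"
  define rs where "rs = sorted_list_of_set D"
  define m where "m = length rs - 1"
  have finD: "finite D" unfolding D_def using fin by simp
  have D0: "0 \<in> D" using False zero unfolding D_def by force
  have D_mem: "d u v \<in> D" if "u \<in> S" "v \<in> S" for u v using that unfolding D_def by force
  have set_rs: "set rs = D" unfolding rs_def using finD by simp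
  have len: "length rs = Suc m" using set_rs D0 unfolding m_def by (cases rs) auto
  have sorted_rs: "sorted_wrt (<) rs" unfolding rs_def by (rule strict_sorted_list_of_set)
  have r_less: "rs ! i < rs ! j" if "i < j" "j \<le> m" for i j
    using sorted_wrt_nth_less[OF sorted_rs] that len by auto
  have r_mono: "rs ! i \<le> rs ! j" if "i \<le> j" "j \<le> m" for i j
    using r_less[of i j] that by (cases "i = j") auto
  have r_idx: "\<exists>j\<le>m. rs ! j = d u v" if "u \<in> S" "v \<in> S" for u v
    using D_mem[OF that] set_rs len by (metis in_set_conv_nth less_Suc_eq_le)
  have r_nn: "0 \<le> rs ! j" if "j \<le> m" for j
    using that len set_rs nonneg nth_mem[of j rs] unfolding D_def by auto
  have r0: "rs ! 0 = 0"
  proof -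
    obtain j where "j \<le> m" "rs ! j = 0" using D0 set_rs len
      by (metis in_set_conv_nth less_Suc_eq_le)
    then show ?thesis using r_mono[of 0 j] r_nn[of 0] by auto
  qed
  have d_le_top: "d u v \<le> rs ! m" if "u \<in> S" "v \<in> S" for u v
    using r_idx[OF that] r_mono by force
  \<comment> \<open>The least element of a ball serves as its canonical name; by
    \<open>rep_eq\<close>, points share a name exactly if they share the ball.\<close>
  define rep where "rep u j = Min {v \<in> S. d u v \<le> rs ! j}" for u j
  have rep_in: "rep u j \<in> S \<and> d u (rep u j) \<le> rs ! j" if "u \<in> S" "j \<le> m" for u j
  proof -
    have "u \<in> {v \<in> S. d u v \<le> rs ! j}" using that zero[of u u] r_nn by auto
    then have "rep u j \<in> {v \<in> S. d u v \<le> rs ! j}" unfolding rep_def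
      using fin by (intro Min_in) auto
    then show ?thesis by auto
  qed
  have rep_eq: "rep u j = rep v j \<longleftrightarrow> d u v \<le> rs ! j" if "u \<in> S" "v \<in> S" "j \<le> m" for u v j
  proof
    assume "rep u j = rep v j"
    then show "d u v \<le> rs ! j"
      using rep_in[OF that(1,3)] rep_in[OF that(2,3)] ultra[of u "rep u j" v] sym[of v "rep u j"] that
      by auto
  next
    assume *: "d u v \<le> rs ! j"
    have "{w \<in> S. d u w \<le> rs ! j} = {w \<in> S. d v w \<le> rs ! j}"
    proof (intro Collect_cong conj_cong refl iffI)
      fix w assume "w \<in> S" "d u w \<le> rs ! j"
      then show "d v w \<le> rs ! j" using ultra[of v u w] sym[of u v] * that by auto
    next
      fix w assume "w \<in> S" "d v w \<le> rs ! j"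
      then show "d u w \<le> rs ! j" using ultra[of u v w] * that by auto
    qed
    then show "rep u j = rep v j" unfolding rep_def by simp
  qed
  obtain e :: "real \<Rightarrow> nat" where e: "inj_on e S"
    using fin finite_imp_inj_to_nat_seg by metis
  \<comment> \<open>Vertices have to be natural numbers. Encoding the level as well keeps apart the
    copies of a ball that does not grow from one radius to the next.\<close>
  define node where "node u j = prod_encode (e (rep u j), j)" for u j
  define lev where "lev w = snd (prod_decode w)" for w
  define pt where "pt w = inv_into S e (fst (prod_decode w))" for w
  \<comment> \<open>The parent is the ball around the same point at the next radius; the top level
    \<open>m\<close> is a fixed point, as a root must be.\<close>
  define p where "p w = (if lev w < m then node (pt w) (Suc (lev w)) else w)" for w
  define V where "V = (\<lambda>(u, j). node u j) ` (S \<times> {..m})"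
  obtain u0 where u0: "u0 \<in> S" using False by auto
  define r where "r = node u0 m"
  have lev_node: "lev (node u j) = j" for u j unfolding lev_def node_def by simp
  have node_eq: "node u i = node v j \<longleftrightarrow> i = j \<and> d u v \<le> rs ! j"
    if "u \<in> S" "v \<in> S" "i \<le> m" "j \<le> m" for u v i j
    using that rep_in rep_eq[of u v j] inj_on_eq_iff[OF e, of "rep u j" "rep v j"]
    unfolding node_def by auto
  have pt_node: "pt (node u j) = rep u j" if "u \<in> S" "j \<le> m" for u j
    unfolding pt_def node_def using that rep_in e by simp
  have p_node: "p (node u j) = node u (Suc j)" if "u \<in> S" "j < m" for u j
  proof -
    have "p (node u j) = node (rep u j) (Suc j)"
      using that pt_node lev_node unfolding p_def by simp
    also have "\<dots> = node u (Suc j)"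
      using that rep_in[of u j] sym[of u "rep u j"] r_mono[of j "Suc j"] by (subst node_eq) auto
    finally show ?thesis .
  qed
  have p_top: "p (node u m) = node u m" for u unfolding p_def using lev_node by simp
  have p_pow: "(p ^^ k) (node u j) = node u (min m (j + k))" if "u \<in> S" "j \<le> m" for u j k
  proof (induction k)
    case 0
    then show ?case using that by simp
  next
    case (Suc k)
    show ?case
    proof (cases "j + k < m")
      case True
      then show ?thesis using Suc p_node[OF that(1)] by simp
    next
      case False
      then show ?thesis using Suc p_top by simp
    qed
  qed
  have top_r: "node u m = r" if "u \<in> S" for u
    unfolding r_def using that u0 d_le_top node_eq by auto
  have node_ne_r: "node u j \<noteq> r" if "u \<in> S" "j < m" for u j
    unfolding r_def using that u0 node_eq[of u u0 j m] by auto
  have V_E: "\<exists>u j. w = node u j \<and> u \<in> S \<and> j \<le> m" if "w \<in> V" for w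
    using that unfolding V_def by auto
  have V_I: "node u j \<in> V" if "u \<in> S" "j \<le> m" for u j using that unfolding V_def by auto
  have anc: "tree_ancestors p (node u j) = {node u i | i. j \<le> i \<and> i \<le> m}"
    if "u \<in> S" "j \<le> m" for u j
  proof -
    have "\<exists>k. node u i = (p ^^ k) (node u j)" if "j \<le> i" "i \<le> m" for i
      using p_pow[OF \<open>u \<in> S\<close> \<open>j \<le> m\<close>, of "i - j"] that by (intro exI[of _ "i - j"]) auto
    moreover have "\<exists>i. (p ^^ k) (node u j) = node u i \<and> j \<le> i \<and> i \<le> m" for k
      using p_pow[OF that, of k] that by (intro exI[of _ "min m (j + k)"]) auto
    ultimately show ?thesis unfolding tree_ancestors_def
      by (intro equalityI subsetI; elim CollectE exE conjE; simp)
  qed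
  have rooted: "rooted_tree V r p"
    unfolding rooted_tree_def
  proof (intro conjI ballI)
    show "finite V" unfolding V_def using fin by simp
    show "r \<in> V" unfolding r_def using u0 V_I by simp
    show "p r = r" unfolding r_def by (rule p_top)
    fix w assume "w \<in> V"
    then obtain u j where w: "w = node u j" "u \<in> S" "j \<le> m" using V_E by blast
    show "p w \<in> V" using p_pow[OF w(2,3), of 1] w V_I by simp
    show "\<exists>k. (p ^^ k) w = r" using p_pow[OF w(2,3), of m] w top_r by (intro exI[of _ m]) auto
  qed
  \<comment> \<open>Every ball above level 0 has the ball around the same point one level below as a
    child, so leaves are the balls of radius 0, that is, the points.\<close>
  have leaf: "tree_leaf V r p (node u j) \<longleftrightarrow> j = 0" if "u \<in> S" "j \<le> m" for u j
  proof
    assume l: "tree_leaf V r p (node u j)"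
    show "j = 0"
    proof (cases j)
      case (Suc i)
      then have "node u i \<in> V - {r}" "p (node u i) = node u j"
        using that node_ne_r V_I p_node by auto
      then show ?thesis using l unfolding tree_leaf_def by blast
    qed
  next
    assume "j = 0"
    have "p c \<noteq> node u j" if c: "c \<in> V - {r}" for c
    proof -
      obtain v i where v: "c = node v i" "v \<in> S" "i \<le> m" using V_E c by blast
      then have "i < m" using c top_r by (cases "i = m") auto
      then have "lev (p c) = Suc i" using p_node v lev_node by simp
      then show ?thesis using lev_node[of u j] \<open>j = 0\<close> by auto
    qed
    then show "tree_leaf V r p (node u j)" unfolding tree_leaf_def using that V_I by blast
  qed
  have leaves: "{w. tree_leaf V r p w} = (\<lambda>u. node u 0) ` S"
  proof
    show "{w. tree_leaf V r p w} \<subseteq> (\<lambda>u. node u 0) ` S"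
    proof
      fix w assume w: "w \<in> {w. tree_leaf V r p w}"
      then have "w \<in> V" unfolding tree_leaf_def by blast
      then obtain u j where "w = node u j" "u \<in> S" "j \<le> m" using V_E by blast
      then show "w \<in> (\<lambda>u. node u 0) ` S" using leaf w by auto
    qed
    show "(\<lambda>u. node u 0) ` S \<subseteq> {w. tree_leaf V r p w}" using leaf by auto
  qed
  have "u = v" if "u \<in> S" "v \<in> S" "node u 0 = node v 0" for u v
    using that node_eq[of u v 0 0] r0 nonneg[of u v] zero[of u v] by simp
  then have bij: "bij_betw (\<lambda>u. node u 0) S {w. tree_leaf V r p w}"
    unfolding bij_betw_def leaves inj_on_def by blast
  have \<phi>0: "rs ! lev w = 0 \<longleftrightarrow> tree_leaf V r p w" if w: "w \<in> V" for w
  proof -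
    obtain u j where w: "w = node u j" "u \<in> S" "j \<le> m" using V_E w by blast
    then show ?thesis using leaf lev_node r0 r_less[of 0 j] by (cases "j = 0") auto
  qed
  have \<phi>p: "rs ! lev w \<le> rs ! lev (p w) / 1" if w: "w \<in> V - {r}" for w
  proof -
    obtain u j where w': "w = node u j" "u \<in> S" "j \<le> m" using V_E w by blast
    then have "j < m" using w top_r by (cases "j = m") auto
    then show ?thesis using w' p_node lev_node r_mono[of j "Suc j"] by simp
  qed
  \<comment> \<open>The ancestor chains of \<open>u\<close> and \<open>v\<close> agree exactly from
    the level whose radius is \<open>d u v\<close> upwards, so the lowest common ancestor has weight
    \<open>d u v\<close>.\<close>
  have lca: "\<exists>w. w \<in> tree_ancestors p (node u 0) \<inter> tree_ancestors p (node v 0)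
        \<and> tree_ancestors p (node u 0) \<inter> tree_ancestors p (node v 0) \<subseteq> tree_ancestors p w
        \<and> d u v = rs ! lev w" if uv: "u \<in> S" "v \<in> S" for u v
  proof -
    obtain j where j: "j \<le> m" "rs ! j = d u v" using r_idx[OF uv] by blast
    have le0: "0 \<le> m" by simp
    have eq: "node u j = node v j" using node_eq[OF uv j(1) j(1)] j(2) by simp
    have sub: "tree_ancestors p (node u 0) \<inter> tree_ancestors p (node v 0) \<subseteq> tree_ancestors p (node u j)"
    proof
      fix w assume "w \<in> tree_ancestors p (node u 0) \<inter> tree_ancestors p (node v 0)"
      then obtain i i' where i: "w = node u i" "i \<le> m" "w = node v i'" "i' \<le> m"
        unfolding anc[OF uv(1) le0] anc[OF uv(2) le0] by blast
      then have "d u v \<le> rs ! i" using node_eq[of u v i i', OF uv i(2,4)] by simp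
      then have "j \<le> i" using r_less[of i j] j by (cases "i < j") auto
      then show "w \<in> tree_ancestors p (node u j)" unfolding anc[OF uv(1) j(1)] using i by blast
    qed
    have "node u j \<in> tree_ancestors p (node u 0)"
      unfolding anc[OF uv(1) le0] using j by blast
    moreover have "node u j \<in> tree_ancestors p (node v 0)"
      unfolding anc[OF uv(2) le0] eq using j by blast
    moreover have "d u v = rs ! lev (node u j)" using j lev_node by simp
    ultimately show ?thesis using sub by blast
  qed
  have \<phi>_nonneg: "0 \<le> rs ! lev w" if "w \<in> V" for w
    using V_E[OF that] lev_node r_nn by auto
  have "is_mu_HST_metric 1 S d"
    unfolding is_mu_HST_metric_def
  proof (intro disjI2 exI conjI)
    show "rooted_tree V r p" by (fact rooted)
    show "\<forall>w\<in>V. 0 \<le> rs ! lev w" using \<phi>_nonneg by (rule ballI)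
    show "\<forall>w\<in>V. (rs ! lev w = 0) = tree_leaf V r p w" using \<phi>0 by (rule ballI)
    show "\<forall>w\<in>V - {r}. rs ! lev w \<le> rs ! lev (p w) / 1" using \<phi>p by (rule ballI)
    show "bij_betw (\<lambda>u. node u 0) S {w. tree_leaf V r p w}" by (fact bij)
    show "\<forall>u\<in>S. \<forall>v\<in>S. \<exists>w. w \<in> tree_ancestors p (node u 0) \<inter> tree_ancestors p (node v 0)
        \<and> tree_ancestors p (node u 0) \<inter> tree_ancestors p (node v 0) \<subseteq> tree_ancestors p w
        \<and> d u v = rs ! lev w"
      using lca by (intro ballI)
  qed
  then show ?thesis unfolding is_HST_metric_def by (intro exI[of _ 1]) auto
qed

section \<open>Surviving cuts\<close>

text \<open>The first point of the sequence is an anchor that later updates cannot change. One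
  offset \<open>a\<close> serves all scales \<open>i\<close> and all cells \<open>k\<close>; only
  the two cuts of a pair use independent offsets.\<close>

definition cut :: "real \<Rightarrow> update_seq \<Rightarrow> int \<Rightarrow> int \<Rightarrow> real" where
  "cut a \<sigma> i k = fst (hd \<sigma>) + 2 powi i * (of_int k + a)"

text \<open>Applied to all points seen so far, dead ones included, so that crowding is never undone.
  The half-open convention, with a point on the cut belonging to its right side, is that of
  \<open>separates\<close>.\<close>

definition crowded :: "real set \<Rightarrow> real \<Rightarrow> real \<Rightarrow> bool" where
  "crowded S \<delta> x \<longleftrightarrow> (\<exists>p\<in>S. \<exists>q\<in>S. p < x \<and> x \<le> q \<and> q - p \<le> \<delta>)"

text \<open>A cut \<open>x\<close> with partner \<open>y\<close> is lost as soon as it is crowded at some time when \<open>y\<close> is not;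
  if both become crowded simultaneously, both are kept.\<close>

definition survives :: "update_seq \<Rightarrow> real \<Rightarrow> real \<Rightarrow> real \<Rightarrow> bool" where
  "survives \<sigma> \<delta> x y \<longleftrightarrow>
     (\<forall>m. crowded (fst ` set (take m \<sigma>)) \<delta> x \<longrightarrow> crowded (fst ` set (take m \<sigma>)) \<delta> y)"

text \<open>This tests only the cuts with the first offset, those with the second being their
  partners; \<open>prod.swap\<close> exchanges the roles.\<close>

definition separates ::
  "nat \<Rightarrow> update_seq \<Rightarrow> real \<Rightarrow> real \<Rightarrow> int \<Rightarrow> real \<times> real \<Rightarrow> bool" where
  "separates n \<sigma> u v i \<omega> \<longleftrightarrow>
     (\<exists>k. u < cut (fst \<omega>) \<sigma> i k \<and> cut (fst \<omega>) \<sigma> i k \<le> v \<and>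
        survives \<sigma> (2 powi i / (real n)\<^sup>2) (cut (fst \<omega>) \<sigma> i k) (cut (snd \<omega>) \<sigma> i k))"

text \<open>The factor 4 pays for domination: two points are always separated at the scale with
  \<open>2 powi i \<le> \<bar>u - v\<bar> / 2 < 2 * 2 powi i\<close>.\<close>

definition cut_height :: "nat \<Rightarrow> update_seq \<Rightarrow> real \<Rightarrow> real \<Rightarrow> real \<times> real \<Rightarrow> int \<Rightarrow> real" where
  "cut_height n \<sigma> u v \<omega> i =
     (if separates n \<sigma> u v i \<omega> \<or> separates n \<sigma> u v i (prod.swap \<omega>) then 4 * 2 powi i else 0)"

definition cut_embedding :: "nat \<Rightarrow> real \<times> real \<Rightarrow> online_embedding" where
  "cut_embedding n \<omega> \<sigma> u v = (SUP i. cut_height n \<sigma> (min u v) (max u v) \<omega> i)"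

definition offsets :: "real set" where
  "offsets = {1/4..3/4}"

lemma crowded_mono: "crowded S \<delta> x \<Longrightarrow> S \<subseteq> T \<Longrightarrow> crowded T \<delta> x"
  unfolding crowded_def by blast

text \<open>Crowding is monotone in time, so the sets of times at which \<open>x\<close> and
  \<open>y\<close> are crowded are upward closed and hence nested.\<close>

lemma survives_total: "survives \<sigma> \<delta> x y \<or> survives \<sigma> \<delta> y x"
proof (rule ccontr)
  assume "\<not> ?thesis"
  then obtain m k where
    m: "crowded (fst ` set (take m \<sigma>)) \<delta> x" "\<not> crowded (fst ` set (take m \<sigma>)) \<delta> y" and
    k: "crowded (fst ` set (take k \<sigma>)) \<delta> y" "\<not> crowded (fst ` set (take k \<sigma>)) \<delta> x"
    unfolding survives_def by blast
  show False
  proof (cases "m \<le> k")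
    case True
    then show False using crowded_mono[OF m(1)] k(2) set_take_subset_set_take[of m k \<sigma>] by blast
  next
    case False
    then show False using crowded_mono[OF k(1)] m(2) set_take_subset_set_take[of k m \<sigma>]
      by (meson image_mono nat_le_linear)
  qed
qed

lemma survives_antimono: "survives (\<sigma> @ [x]) \<delta> y z \<Longrightarrow> survives \<sigma> \<delta> y z"
  unfolding survives_def
proof (intro allI)
  fix m
  assume *: "\<forall>m. crowded (fst ` set (take m (\<sigma> @ [x]))) \<delta> y \<longrightarrow>
    crowded (fst ` set (take m (\<sigma> @ [x]))) \<delta> z"
  \<comment> \<open>Truncating \<open>m\<close> at the old length prevents the prefix of the
    extended sequence from picking up \<open>x\<close>.\<close>
  have "take (min m (length \<sigma>)) (\<sigma> @ [x]) = take m \<sigma>" by (auto simp: min_def)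
  then show "crowded (fst ` set (take m \<sigma>)) \<delta> y \<longrightarrow> crowded (fst ` set (take m \<sigma>)) \<delta> z"
    using *[rule_format, of "min m (length \<sigma>)"] by simp
qed

text \<open>Offsets keep away from 0 and 1, so a cut of scale \<open>2 powi i\<close> stays at distance at least
  \<open>2 powi i / 4\<close> from the first point of the sequence: large scales cannot separate nearby points.\<close>

lemma separates_scale_le:
  assumes "separates n \<sigma> u v i \<omega>" "fst \<omega> \<in> offsets"
  shows "2 powi i \<le> 4 * (\<bar>u - fst (hd \<sigma>)\<bar> + \<bar>v - fst (hd \<sigma>)\<bar>)"
proof -
  obtain k where k: "u < cut (fst \<omega>) \<sigma> i k" "cut (fst \<omega>) \<sigma> i k \<le> v"
    using assms(1) unfolding separates_def by blast
  have "1/4 \<le> \<bar>of_int k + fst \<omega>\<bar>"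
    using assms(2) unfolding offsets_def by (cases "k \<ge> 0") (auto simp: abs_if)
  then have "2 powi i * (1/4) \<le> 2 powi i * \<bar>of_int k + fst \<omega>\<bar>"
    by (intro mult_left_mono) auto
  also have "\<dots> = \<bar>cut (fst \<omega>) \<sigma> i k - fst (hd \<sigma>)\<bar>"
    unfolding cut_def by (simp add: abs_mult)
  also have "\<dots> \<le> \<bar>u - fst (hd \<sigma>)\<bar> + \<bar>v - fst (hd \<sigma>)\<bar>" using k by linarith
  finally show ?thesis by simp
qed

section \<open>Boundedness and the ultrametric inequality\<close>

lemma cut_height_le:
  assumes "\<omega> \<in> offsets \<times> offsets"
  shows "cut_height n \<sigma> u v \<omega> i \<le> 16 * (\<bar>u - fst (hd \<sigma>)\<bar> + \<bar>v - fst (hd \<sigma>)\<bar>)"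
  using separates_scale_le[of n \<sigma> u v i \<omega>] separates_scale_le[of n \<sigma> u v i "prod.swap \<omega>"] assms
  unfolding cut_height_def by (auto simp: mem_Times_iff)

lemma bdd_above_cut_height:
  assumes "\<omega> \<in> offsets \<times> offsets"
  shows "bdd_above (range (cut_height n \<sigma> u v \<omega>))"
  using cut_height_le[OF assms] by (intro bdd_aboveI) auto

text \<open>A cut between \<open>u\<close> and \<open>w\<close> also lies between \<open>u\<close>
  and \<open>v\<close> or between \<open>v\<close> and \<open>w\<close>, and its survival does not
  depend on the pair it is tested on.\<close>

lemma cut_embedding_ultra:
  assumes "\<omega> \<in> offsets \<times> offsets"
  shows "cut_embedding n \<omega> \<sigma> u w \<le> max (cut_embedding n \<omega> \<sigma> u v) (cut_embedding n \<omega> \<sigma> v w)"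
  unfolding cut_embedding_def
proof (rule cSUP_least)
  fix i :: int
  have sep: "separates n \<sigma> (min u v) (max u v) i \<omega>' \<or> separates n \<sigma> (min v w) (max v w) i \<omega>'"
    if s: "separates n \<sigma> (min u w) (max u w) i \<omega>'" for \<omega>'
  proof -
    obtain k where k: "min u w < cut (fst \<omega>') \<sigma> i k" "cut (fst \<omega>') \<sigma> i k \<le> max u w"
      and sv: "survives \<sigma> (2 powi i / (real n)\<^sup>2) (cut (fst \<omega>') \<sigma> i k) (cut (snd \<omega>') \<sigma> i k)"
      using s unfolding separates_def by blast
    have "min u v < cut (fst \<omega>') \<sigma> i k \<and> cut (fst \<omega>') \<sigma> i k \<le> max u v \<or>
          min v w < cut (fst \<omega>') \<sigma> i k \<and> cut (fst \<omega>') \<sigma> i k \<le> max v w"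
      using k by linarith
    then show ?thesis using sv unfolding separates_def by blast
  qed
  have "cut_height n \<sigma> (min u w) (max u w) \<omega> i \<le>
      max (cut_height n \<sigma> (min u v) (max u v) \<omega> i) (cut_height n \<sigma> (min v w) (max v w) \<omega> i)"
    unfolding cut_height_def using sep[of \<omega>] sep[of "prod.swap \<omega>"] by (auto simp: max_def)
  also have "\<dots> \<le> max (SUP i. cut_height n \<sigma> (min u v) (max u v) \<omega> i)
      (SUP i. cut_height n \<sigma> (min v w) (max v w) \<omega> i)"
    by (intro max.mono cSUP_upper bdd_above_cut_height[OF assms] UNIV_I)
  finally show "cut_height n \<sigma> (min u w) (max u w) \<omega> i \<le> \<dots>" .
qed simp

lemma cut_embedding_sym: "cut_embedding n \<omega> \<sigma> u v = cut_embedding n \<omega> \<sigma> v u"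
  unfolding cut_embedding_def by (simp add: min.commute max.commute)

lemma cut_embedding_self: "cut_embedding n \<omega> \<sigma> u u = 0"
proof -
  have "cut_height n \<sigma> u u \<omega> i = 0" for i unfolding cut_height_def separates_def by auto
  then show ?thesis unfolding cut_embedding_def by simp
qed

section \<open>Domination and monotonicity\<close>

lemma dyadic_scale:
  fixes L :: real
  assumes "0 < L"
  shows "\<exists>i::int. 2 powi i \<le> L \<and> L < 2 * 2 powi i"
proof -
  define i where "i = \<lfloor>log 2 L\<rfloor>"
  have "(2::real) powi i = 2 powr of_int i" by (simp add: powr_real_of_int')
  moreover have "(2::real) powr of_int i \<le> 2 powr (log 2 L)" unfolding i_def by (intro powr_mono) auto
  moreover have "(2::real) powr (log 2 L) < 2 powr (of_int i + 1)"
    unfolding i_def by (intro powr_less_mono) linarith+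
  ultimately show ?thesis using assms by (intro exI[of _ i]) (auto simp: powr_add)
qed

text \<open>At a scale of at most half the distance, a whole grid cell fits between the two points.
  It contains both cuts of a pair, and one of them survives by
  \<open>survives_total\<close>.\<close>

lemma cut_embedding_ge:
  assumes \<omega>: "\<omega> \<in> offsets \<times> offsets"
  shows "\<bar>u - v\<bar> \<le> cut_embedding n \<omega> \<sigma> u v"
proof (cases "u = v")
  case True
  then show ?thesis by (simp add: cut_embedding_self)
next
  case False
  obtain i :: int where i: "2 powi i \<le> \<bar>u - v\<bar> / 2" "\<bar>u - v\<bar> / 2 < 2 * 2 powi i"
    using dyadic_scale[of "\<bar>u - v\<bar> / 2"] False by auto
  define s :: real where "s = 2 powi i"
  have s: "0 < s" unfolding s_def by simp
  have width: "max u v - min u v = \<bar>u - v\<bar>" by (cases "u \<le> v") auto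
  define k where "k = \<lceil>(min u v - fst (hd \<sigma>)) / s\<rceil>"
  have k: "(min u v - fst (hd \<sigma>)) / s \<le> of_int k" "of_int k < (min u v - fst (hd \<sigma>)) / s + 1"
    unfolding k_def by linarith+
  have inside: "min u v < cut a \<sigma> i k \<and> cut a \<sigma> i k \<le> max u v" if "a \<in> offsets" for a
  proof
    have a: "0 < a" "a < 1" using that unfolding offsets_def by auto
    have "min u v - fst (hd \<sigma>) \<le> s * of_int k" using k(1) s by (simp add: field_simps)
    moreover have "0 < s * a" using s a by simp
    ultimately show "min u v < cut a \<sigma> i k" unfolding cut_def s_def[symmetric]
      by (simp add: algebra_simps)
    have "s * of_int k < min u v - fst (hd \<sigma>) + s" using k(2) s by (simp add: field_simps)
    moreover have "s * a < s" using s a by simp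
    moreover have "2 * s \<le> max u v - min u v"
      using i(1) width unfolding s_def[symmetric] by simp
    ultimately show "cut a \<sigma> i k \<le> max u v" unfolding cut_def s_def[symmetric]
      by (simp add: algebra_simps)
  qed
  have off: "fst \<omega> \<in> offsets" "snd \<omega> \<in> offsets" using \<omega> by auto
  have "separates n \<sigma> (min u v) (max u v) i \<omega> \<or>
      separates n \<sigma> (min u v) (max u v) i (prod.swap \<omega>)"
    using survives_total[of \<sigma> "2 powi i / (real n)\<^sup>2" "cut (fst \<omega>) \<sigma> i k" "cut (snd \<omega>) \<sigma> i k"]
      inside[OF off(1)] inside[OF off(2)] unfolding separates_def fst_swap snd_swap by blast
  then have "cut_height n \<sigma> (min u v) (max u v) \<omega> i = 4 * 2 powi i" unfolding cut_height_def by simp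
  moreover have "cut_height n \<sigma> (min u v) (max u v) \<omega> i \<le> cut_embedding n \<omega> \<sigma> u v"
    unfolding cut_embedding_def by (intro cSUP_upper bdd_above_cut_height[OF \<omega>]) auto
  moreover have "\<bar>u - v\<bar> \<le> 4 * 2 powi i" using i(2) by simp
  ultimately show ?thesis by simp
qed

text \<open>A nonempty sequence keeps its anchor and thus its cuts, and a longer sequence only adds
  survival conditions, so no scale can gain height.\<close>

lemma cut_embedding_antimono:
  assumes \<omega>: "\<omega> \<in> offsets \<times> offsets" and "\<sigma> \<noteq> []"
  shows "cut_embedding n \<omega> (\<sigma> @ [x]) u v \<le> cut_embedding n \<omega> \<sigma> u v"
  unfolding cut_embedding_def
proof (rule cSUP_mono)
  fix i
  have "cut a (\<sigma> @ [x]) i k = cut a \<sigma> i k" for a k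
    unfolding cut_def using \<open>\<sigma> \<noteq> []\<close> by simp
  then have "separates n \<sigma> u' v' i \<omega>'" if "separates n (\<sigma> @ [x]) u' v' i \<omega>'" for u' v' \<omega>'
    using that survives_antimono unfolding separates_def by metis
  then have "cut_height n (\<sigma> @ [x]) (min u v) (max u v) \<omega> i \<le> cut_height n \<sigma> (min u v) (max u v) \<omega> i"
    unfolding cut_height_def by auto
  then show "\<exists>j\<in>UNIV. cut_height n (\<sigma> @ [x]) (min u v) (max u v) \<omega> i \<le>
      cut_height n \<sigma> (min u v) (max u v) \<omega> j" by blast
qed (use bdd_above_cut_height[OF \<omega>] in auto)

section \<open>Validity as an online embedding\<close>

lemma alive_snoc: "alive (\<sigma> @ [x]) = update_step (alive \<sigma>) x"
  unfolding alive_def by simp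

lemma alive_subset: "alive \<sigma> \<subseteq> fst ` set \<sigma>"
proof (induction \<sigma> rule: rev_induct)
  case Nil
  then show ?case by (simp add: alive_def)
next
  case (snoc x \<sigma>)
  then show ?case by (cases "(alive \<sigma>, x)" rule: update_step.cases) (auto simp: alive_snoc)
qed

lemma cut_embedding_online:
  assumes \<omega>: "\<omega> \<in> offsets \<times> offsets"
  shows "online_monotone_HST_embedding n (cut_embedding n \<omega>)"
  unfolding online_monotone_HST_embedding_def
proof (intro allI impI conjI ballI)
  fix \<sigma> :: update_seq
  show "is_HST_metric (alive \<sigma>) (cut_embedding n \<omega> \<sigma>)"
  proof (rule ultrametric_is_HST_metric)
    show "finite (alive \<sigma>)" using alive_subset by (rule finite_subset) simp
    show "cut_embedding n \<omega> \<sigma> u v = 0 \<longleftrightarrow> u = v" for u v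
      using cut_embedding_ge[OF \<omega>, of u v n \<sigma>] by (auto simp: cut_embedding_self)
    show "0 \<le> cut_embedding n \<omega> \<sigma> u v" for u v
      using cut_embedding_ge[OF \<omega>, of u v n \<sigma>] by linarith
  qed (rule cut_embedding_sym cut_embedding_ultra[OF \<omega>])+
  show "\<bar>u - v\<bar> \<le> cut_embedding n \<omega> \<sigma> u v" for u v by (rule cut_embedding_ge[OF \<omega>])
  fix x u v assume "u \<in> alive \<sigma> \<inter> alive (\<sigma> @ [x])"
  then have "\<sigma> \<noteq> []" using alive_subset by fastforce
  then show "cut_embedding n \<omega> (\<sigma> @ [x]) u v \<le> cut_embedding n \<omega> \<sigma> u v"
    by (rule cut_embedding_antimono[OF \<omega>])
qed

section \<open>Expected distances\<close>

text \<open>The space itself is cut down to \<open>offsets\<close>, so that bounds valid for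
  admissible offsets hold at every outcome and not just almost everywhere.\<close>

definition offset_measure :: "real measure" where
  "offset_measure = restrict_space (uniform_measure lborel offsets) offsets"

lemma sets_offsets [measurable]: "offsets \<in> sets borel"
  unfolding offsets_def by simp

lemma space_offset_measure: "space offset_measure = offsets"
  unfolding offset_measure_def by (simp add: space_restrict_space)

lemma prob_space_offset_measure: "prob_space offset_measure"
proof -
  interpret U: prob_space "uniform_measure lborel offsets"
    by (rule prob_space_uniform_measure) (auto simp: offsets_def)
  have "emeasure (uniform_measure lborel offsets) offsets = 1"
    by (intro emeasure_uniform_measure_1) (auto simp: offsets_def)
  then show ?thesis unfolding offset_measure_def
    by (intro prob_space_restrict_space) auto
qed

lemma sets_offset_measure: "A \<in> sets offset_measure \<longleftrightarrow> A \<in> sets borel \<and> A \<subseteq> offsets"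
  unfolding offset_measure_def by (subst sets_restrict_space_iff) auto

lemma measure_offset_interval:
  assumes "\<alpha> \<le> \<beta>"
  shows "measure offset_measure ({\<alpha><..\<beta>} \<inter> offsets) \<le> 2 * (\<beta> - \<alpha>)"
proof -
  have "emeasure offset_measure ({\<alpha><..\<beta>} \<inter> offsets) =
      emeasure lborel ({\<alpha><..\<beta>} \<inter> offsets) / emeasure lborel offsets"
    unfolding offset_measure_def
    by (subst emeasure_restrict_space) (auto simp: emeasure_uniform_measure Int_commute)
  \<comment> \<open>The reciprocal of this length is the density 2 in the bound.\<close>
  also have "emeasure lborel offsets = ennreal (1/2)" unfolding offsets_def by simp
  also have "emeasure lborel ({\<alpha><..\<beta>} \<inter> offsets) / ennreal (1/2) \<le> ennreal (\<beta> - \<alpha>) / ennreal (1/2)"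
  proof (intro divide_right_mono_ennreal)
    have "emeasure lborel ({\<alpha><..\<beta>} \<inter> offsets) \<le> emeasure lborel {\<alpha><..\<beta>}"
      by (intro emeasure_mono) auto
    then show "emeasure lborel ({\<alpha><..\<beta>} \<inter> offsets) \<le> ennreal (\<beta> - \<alpha>)" using assms by simp
  qed
  also have "\<dots> = ennreal (2 * (\<beta> - \<alpha>))"
    using assms by (subst divide_ennreal) (auto simp: mult.commute)
  finally show ?thesis using assms by (simp add: measure_def enn2real_leI)
qed

section \<open>Pairs of independent offsets and measurability\<close>

abbreviation offset_pairs :: "(real \<times> real) measure" where
  "offset_pairs \<equiv> offset_measure \<Otimes>\<^sub>M offset_measure"

lemma space_offset_pairs: "space offset_pairs = offsets \<times> offsets"
  by (simp add: space_pair_measure space_offset_measure)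

lemma prob_space_offset_pairs: "prob_space offset_pairs"
proof -
  interpret U: prob_space offset_measure by (rule prob_space_offset_measure)
  interpret UU: pair_prob_space offset_measure offset_measure ..
  show ?thesis by (rule UU.prob_space_axioms)
qed

lemma measurable_offset: "(\<lambda>x. x) \<in> borel_measurable offset_measure"
  unfolding offset_measure_def by (intro measurable_restrict_space1) simp

lemma measurable_fst_offset [measurable]: "fst \<in> borel_measurable offset_pairs"
  using measurable_compose[OF measurable_fst[of offset_measure offset_measure] measurable_offset] by simp

lemma measurable_snd_offset [measurable]: "snd \<in> borel_measurable offset_pairs"
  using measurable_compose[OF measurable_snd[of offset_measure offset_measure] measurable_offset] by simp

text \<open>The quantifiers range over integers, naturals and finite sets of points, all countable.
  General \<open>f\<close> and \<open>g\<close> cover both orders of the offsets.\<close>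

lemma measurable_separates [measurable]:
  assumes [measurable]: "f \<in> borel_measurable M" "g \<in> borel_measurable M"
  shows "Measurable.pred M (\<lambda>\<omega>. separates n \<sigma> u v i (f \<omega>, g \<omega>))"
  unfolding separates_def survives_def crowded_def cut_def by simp measurable

lemma measurable_cut_embedding:
  "(\<lambda>\<omega>. cut_embedding n \<omega> \<sigma> u v) \<in> borel_measurable offset_pairs"
  unfolding cut_embedding_def
proof (rule borel_measurable_cSUP)
  fix i
  have "(\<lambda>\<omega>. cut_height n \<sigma> (min u v) (max u v) (fst \<omega>, snd \<omega>) i) \<in> borel_measurable offset_pairs"
    unfolding cut_height_def prod.swap_def fst_conv snd_conv by measurable
  then show "(\<lambda>\<omega>. cut_height n \<sigma> (min u v) (max u v) \<omega> i) \<in> borel_measurable offset_pairs" by simp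
qed (use bdd_above_cut_height in \<open>auto simp: space_offset_pairs\<close>)


section \<open>Separation probabilities\<close>

lemma measure_cut_interval:
  assumes "u \<le> v"
  shows "measure offset_measure {a \<in> offsets. u < cut a \<sigma> i k \<and> cut a \<sigma> i k \<le> v}
    \<le> 2 * (v - u) / 2 powi i"
proof -
  define s :: real where "s = 2 powi i"
  have s: "0 < s" unfolding s_def by simp
  \<comment> \<open>Solving \<open>u < cut a \<sigma> i k \<le> v\<close> for the offset
    \<open>a\<close> gives an interval of length \<open>(v - u) / s\<close>.\<close>
  define \<alpha> \<beta> where "\<alpha> = (u - fst (hd \<sigma>)) / s - of_int k" and "\<beta> = (v - fst (hd \<sigma>)) / s - of_int k"
  have eq: "{a \<in> offsets. u < cut a \<sigma> i k \<and> cut a \<sigma> i k \<le> v} = {\<alpha><..\<beta>} \<inter> offsets"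
    unfolding cut_def s_def[symmetric] \<alpha>_def \<beta>_def using s by (auto simp: field_simps)
  have "\<beta> - \<alpha> = (v - u) / s" unfolding \<alpha>_def \<beta>_def by (simp add: diff_divide_distrib)
  moreover have "\<alpha> \<le> \<beta>" using assms s unfolding \<alpha>_def \<beta>_def by (simp add: divide_right_mono)
  ultimately show ?thesis
    unfolding eq using measure_offset_interval[of \<alpha> \<beta>] by (simp add: s_def)
qed

text \<open>An interval no longer than one cell meets at most two consecutive cells.\<close>

lemma cut_index_cases:
  assumes "a \<in> offsets" "u < cut a \<sigma> i k" "cut a \<sigma> i k \<le> v" "v - u \<le> 2 powi i"
  shows "k \<in> {\<lfloor>(u - fst (hd \<sigma>)) / 2 powi i\<rfloor>, \<lfloor>(u - fst (hd \<sigma>)) / 2 powi i\<rfloor> + 1}"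
proof -
  define s :: real where "s = 2 powi i"
  have s: "0 < s" unfolding s_def by simp
  define \<alpha> where "\<alpha> = (u - fst (hd \<sigma>)) / s"
  have a: "0 < a" "a < 1" using assms(1) unfolding offsets_def by auto
  have "\<alpha> < of_int k + a"
    using assms(2) s unfolding \<alpha>_def cut_def s_def[symmetric] by (simp add: field_simps)
  moreover have "of_int k + a \<le> \<alpha> + 1"
  proof -
    have "s * (of_int k + a) \<le> u - fst (hd \<sigma>) + s"
      using assms(3,4) unfolding cut_def s_def[symmetric] by linarith
    then show ?thesis using s unfolding \<alpha>_def by (simp add: field_simps)
  qed
  ultimately have "k = \<lfloor>\<alpha>\<rfloor> \<or> k = \<lfloor>\<alpha>\<rfloor> + 1" using a by linarith
  then show ?thesis unfolding \<alpha>_def s_def by simp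
qed

text \<open>If \<open>v - u\<close> is at most the crowding threshold, a cut between \<open>u\<close> and \<open>v\<close> is crowded
  by them, so it survives only if its independent partner is crowded as well.\<close>

lemma prob_separates:
  fixes n :: nat and i :: int
  defines "s \<equiv> 2 powi i" and "\<delta> \<equiv> 2 powi i / (real n)\<^sup>2"
  assumes uv: "u \<in> fst ` set \<sigma>" "v \<in> fst ` set \<sigma>" "u < v" and small: "v - u \<le> s"
  shows "measure offset_pairs {\<omega> \<in> space offset_pairs. separates n \<sigma> u v i \<omega>}
    \<le> (if \<delta> < v - u then 4 * (v - u) / s else 0) +
      (\<Sum>p\<in>fst ` set \<sigma>. \<Sum>q\<in>fst ` set \<sigma>.
         if p < q \<and> q - p \<le> \<delta> then 8 * (v - u) * (q - p) / s\<^sup>2 else 0)"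
    (is "measure _ ?X \<le> ?near + ?crowd")
proof -
  interpret U: prob_space offset_measure by (rule prob_space_offset_measure)
  interpret P: prob_space offset_pairs by (rule prob_space_offset_pairs)
  define S where "S = fst ` set \<sigma>"
  have finS: "finite S" unfolding S_def by simp
  have s: "0 < s" unfolding s_def by simp
  define K where "K = {\<lfloor>(u - fst (hd \<sigma>)) / s\<rfloor>, \<lfloor>(u - fst (hd \<sigma>)) / s\<rfloor> + 1}"
  have K: "finite K" "card K = 2" unfolding K_def by auto
  define B where "B x y k = {a \<in> offsets. x < cut a \<sigma> i k \<and> cut a \<sigma> i k \<le> y}" for x y k
  have B_sets: "B x y k \<in> sets offset_measure" for x y k
    unfolding sets_offset_measure B_def cut_def by auto
  have B_le: "measure offset_measure (B x y k) \<le> 2 * (y - x) / s" if "x \<le> y" for x y k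
    unfolding B_def s_def by (rule measure_cut_interval[OF that])
  have rect: "measure offset_pairs (B x y k \<times> B x' y' k) =
      measure offset_measure (B x y k) * measure offset_measure (B x' y' k)" for x y x' y' k
    using B_sets by (simp add: measure_def U.emeasure_pair_measure_Times enn2real_mult)
  have rect_sets: "B x y k \<times> B x' y' k \<in> sets offset_pairs" for x y x' y' k
    using B_sets by auto
  have off_sets: "offsets \<in> sets offset_measure" unfolding sets_offset_measure by auto
  have crowd_nn: "0 \<le> ?crowd" using uv s by (intro sum_nonneg) auto
  show ?thesis
  proof (cases "\<delta> < v - u")
    \<comment> \<open>Above the threshold survival is ignored: a union bound over the two possible
      cells, each with probability at most \<open>2 * (v - u) / s\<close>.\<close>
    case True
    have "?X \<subseteq> (\<Union>k\<in>K. B u v k \<times> offsets)"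
    proof
      fix \<omega> assume \<omega>: "\<omega> \<in> ?X"
      then obtain k where k: "u < cut (fst \<omega>) \<sigma> i k" "cut (fst \<omega>) \<sigma> i k \<le> v"
        unfolding separates_def by blast
      have off: "fst \<omega> \<in> offsets" "snd \<omega> \<in> offsets"
        using \<omega> by (auto simp: space_offset_pairs mem_Times_iff)
      have "k \<in> K" unfolding K_def s_def
        by (rule cut_index_cases[OF off(1) k]) (use small s_def in simp)
      then show "\<omega> \<in> (\<Union>k\<in>K. B u v k \<times> offsets)"
        using k off unfolding B_def by (auto simp: mem_Times_iff)
    qed
    then have "measure offset_pairs ?X \<le> measure offset_pairs (\<Union>k\<in>K. B u v k \<times> offsets)"
      using B_sets off_sets K by (intro P.finite_measure_mono) auto
    also have "\<dots> \<le> (\<Sum>k\<in>K. measure offset_pairs (B u v k \<times> offsets))"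
      using B_sets off_sets K by (intro P.finite_measure_subadditive_finite) auto
    also have "\<dots> \<le> (\<Sum>k\<in>K. 2 * (v - u) / s)"
    proof (intro sum_mono)
      fix k
      have "measure offset_pairs (B u v k \<times> offsets) =
          measure offset_measure (B u v k) * measure offset_measure offsets"
        using B_sets off_sets by (simp add: measure_def U.emeasure_pair_measure_Times enn2real_mult)
      also have "measure offset_measure offsets = 1"
        using U.prob_space by (simp add: space_offset_measure)
      finally show "measure offset_pairs (B u v k \<times> offsets) \<le> 2 * (v - u) / s"
        using B_le[of u v k] uv by simp
    qed
    also have "\<dots> = ?near" using True K by simp
    finally show ?thesis using crowd_nn by linarith
  next
    case False
    define PQ where "PQ = {(p, q) \<in> S \<times> S. p < q \<and> q - p \<le> \<delta>}"
    have PQ: "finite PQ" unfolding PQ_def using finS by (auto intro: finite_subset[of _ "S \<times> S"])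
    \<comment> \<open>The event is covered by rectangles: the first offset puts the cut between
      \<open>u\<close> and \<open>v\<close>, the second puts its partner between a close pair
      \<open>p\<close>, \<open>q\<close>. Independence multiplies the two bounds, and the two cells
      \<open>k\<close> turn the factor 4 into 8.\<close>
    have "?X \<subseteq> (\<Union>(k, p, q)\<in>K \<times> PQ. B u v k \<times> B p q k)"
    proof
      fix \<omega> assume \<omega>: "\<omega> \<in> ?X"
      then obtain k where k: "u < cut (fst \<omega>) \<sigma> i k" "cut (fst \<omega>) \<sigma> i k \<le> v"
        and sv: "survives \<sigma> \<delta> (cut (fst \<omega>) \<sigma> i k) (cut (snd \<omega>) \<sigma> i k)"
        unfolding separates_def \<delta>_def by blast
      have off: "fst \<omega> \<in> offsets" "snd \<omega> \<in> offsets"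
        using \<omega> by (auto simp: space_offset_pairs mem_Times_iff)
      have kK: "k \<in> K" unfolding K_def s_def
        by (rule cut_index_cases[OF off(1) k]) (use small s_def in simp)
      have "crowded S \<delta> (cut (fst \<omega>) \<sigma> i k)"
        unfolding crowded_def S_def using uv k False by (intro bexI[of _ u] bexI[of _ v]) auto
      \<comment> \<open>Survival is used at the final time only, where the prefix is all of
        \<open>\<sigma>\<close>.\<close>
      then have "crowded S \<delta> (cut (snd \<omega>) \<sigma> i k)"
        using sv[unfolded survives_def, rule_format, of "length \<sigma>"] unfolding S_def by simp
      then obtain p q where pq: "p \<in> S" "q \<in> S" "p < cut (snd \<omega>) \<sigma> i k"
          "cut (snd \<omega>) \<sigma> i k \<le> q" "q - p \<le> \<delta>"
        unfolding crowded_def by blast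
      then have "(p, q) \<in> PQ" unfolding PQ_def by auto
      moreover have "\<omega> \<in> B u v k \<times> B p q k"
        using k pq off unfolding B_def by (auto simp: mem_Times_iff)
      ultimately show "\<omega> \<in> (\<Union>(k, p, q)\<in>K \<times> PQ. B u v k \<times> B p q k)" using kK by blast
    qed
    then have "measure offset_pairs ?X \<le> measure offset_pairs (\<Union>(k, p, q)\<in>K \<times> PQ. B u v k \<times> B p q k)"
      using rect_sets K PQ by (intro P.finite_measure_mono sets.finite_UN) (auto simp: split_beta)
    also have "\<dots> \<le> (\<Sum>x\<in>K \<times> PQ. measure offset_pairs (case x of (k, p, q) \<Rightarrow> B u v k \<times> B p q k))"
      using rect_sets K PQ by (intro P.finite_measure_subadditive_finite) (auto simp: split_beta)
    also have "\<dots> \<le> (\<Sum>x\<in>K \<times> PQ. case x of (k, p, q) \<Rightarrow> 4 * (v - u) * (q - p) / s\<^sup>2)"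
    proof (intro sum_mono, clarify)
      fix k p q assume "(p, q) \<in> PQ"
      then have "p \<le> q" unfolding PQ_def by auto
      then have "measure offset_measure (B u v k) * measure offset_measure (B p q k) \<le>
          (2 * (v - u) / s) * (2 * (q - p) / s)"
        using uv s by (intro mult_mono B_le) auto
      then show "measure offset_pairs (B u v k \<times> B p q k) \<le> 4 * (v - u) * (q - p) / s\<^sup>2"
        unfolding rect by (simp add: power2_eq_square algebra_simps)
    qed
    also have "\<dots> = (\<Sum>k\<in>K. \<Sum>(p, q)\<in>PQ. 4 * (v - u) * (q - p) / s\<^sup>2)"
      unfolding sum.cartesian_product by (intro sum.cong) auto
    also have "\<dots> = (\<Sum>(p, q)\<in>PQ. 8 * (v - u) * (q - p) / s\<^sup>2)"
      unfolding sum_constant K(2) sum_distrib_left by (intro sum.cong) auto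
    also have "\<dots> = (\<Sum>(p, q)\<in>S \<times> S. if p < q \<and> q - p \<le> \<delta> then 8 * (v - u) * (q - p) / s\<^sup>2 else 0)"
      unfolding PQ_def using finS by (intro sum.mono_neutral_cong_left) (auto split: if_splits)
    also have "\<dots> = ?crowd" by (simp add: sum.cartesian_product S_def)
    finally show ?thesis using False by simp
  qed
qed

section \<open>Sums over dyadic scales\<close>

lemma sum_geometric_tail_le:
  fixes x t N :: real
  assumes "0 < x" "0 < t" "0 < N"
  shows "(\<Sum>j<J. if x * N \<le> t * 2 ^ j then x / (t * 2 ^ j) else 0) \<le> 2 / N"
proof -
  \<comment> \<open>The induction needs a stronger bound: \<open>2 * (x / (t * 2 ^ J))\<close> is
    the whole geometric series still to come. The maximum with 0 covers the indices before the
    condition first holds; from then on terms are at most \<open>1 / N\<close> and halve.\<close>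
  have "(\<Sum>j<J. if x * N \<le> t * 2 ^ j then x / (t * 2 ^ j) else 0)
      \<le> max 0 (2 / N - 2 * (x / (t * 2 ^ J)))"
  proof (induction J)
    case 0
    then show ?case by simp
  next
    case (Suc J)
    define y where "y = x / (t * 2 ^ J)"
    have half: "2 * (x / (t * 2 ^ Suc J)) = y" unfolding y_def by simp
    have pos: "0 < y" unfolding y_def using assms by simp
    have "y \<le> 1 / N" if "x * N \<le> t * 2 ^ J"
      using that assms unfolding y_def by (simp add: field_simps)
    then show ?case
      using Suc pos unfolding half y_def[symmetric] sum.lessThan_Suc
      by (cases "x * N \<le> t * 2 ^ J") (auto simp: max_def split: if_splits)
  qed
  also have "\<dots> \<le> 2 / N" using assms by simp
  finally show ?thesis .
qed

text \<open>This is the source of the logarithm: from \<open>L \<le> t\<close> a counted scale has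
  \<open>2 ^ j < n^2\<close>, that is, \<open>j < 2 * log 2 n\<close>; rounding up costs the
  1.\<close>

lemma count_scales_le:
  fixes n :: nat and t L :: real
  assumes "1 \<le> n" "0 < L" "L \<le> t"
  shows "(\<Sum>j<J. if t * 2 ^ j / (real n)\<^sup>2 < L then 1 else 0 :: real) \<le> 2 * log 2 n + 1"
proof -
  have "{j. j < J \<and> t * 2 ^ j / (real n)\<^sup>2 < L} \<subseteq> {..<nat \<lceil>2 * log 2 n\<rceil>}"
  proof
    fix j assume "j \<in> {j. j < J \<and> t * 2 ^ j / (real n)\<^sup>2 < L}"
    then have "t * 2 ^ j < L * (real n)\<^sup>2" using assms by (simp add: field_simps)
    also have "\<dots> \<le> t * (real n)\<^sup>2" using assms by (intro mult_right_mono) auto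
    finally have "2 ^ j < (real n)\<^sup>2" using assms by simp
    then have "log 2 (2 ^ j) < log 2 ((real n)\<^sup>2)" using assms by (subst log_less_cancel_iff) auto
    then have "real j < 2 * log 2 n" using assms by (simp add: log_nat_power)
    then show "j \<in> {..<nat \<lceil>2 * log 2 n\<rceil>}" by simp linarith
  qed
  then have "card {j. j < J \<and> t * 2 ^ j / (real n)\<^sup>2 < L} \<le> nat \<lceil>2 * log 2 n\<rceil>"
    using card_mono[of "{..<nat \<lceil>2 * log 2 n\<rceil>}"] by auto
  moreover have "real (nat \<lceil>2 * log 2 n\<rceil>) \<le> 2 * log 2 n + 1"
  proof -
    have "0 \<le> log 2 n" using assms by simp
    then show ?thesis by linarith
  qed
  moreover have "(\<Sum>j<J. if t * 2 ^ j / (real n)\<^sup>2 < L then 1 else 0 :: real) =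
      card {j. j < J \<and> t * 2 ^ j / (real n)\<^sup>2 < L}"
    by (subst sum.If_cases) (auto intro!: arg_cong[of _ _ card])
  ultimately show ?thesis by linarith
qed

section \<open>The expected distance\<close>

lemma integrable_cut_embedding: "integrable offset_pairs (\<lambda>\<omega>. cut_embedding n \<omega> \<sigma> u v)"
proof -
  interpret P: prob_space offset_pairs by (rule prob_space_offset_pairs)
  have "norm (cut_embedding n \<omega> \<sigma> u v) \<le>
      16 * (\<bar>min u v - fst (hd \<sigma>)\<bar> + \<bar>max u v - fst (hd \<sigma>)\<bar>)"
    if \<omega>: "\<omega> \<in> space offset_pairs" for \<omega>
  proof -
    have "0 \<le> cut_embedding n \<omega> \<sigma> u v"
      using cut_embedding_ge[of \<omega> u v n \<sigma>] \<omega> by (simp add: space_offset_pairs)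
    moreover have "cut_embedding n \<omega> \<sigma> u v \<le>
        16 * (\<bar>min u v - fst (hd \<sigma>)\<bar> + \<bar>max u v - fst (hd \<sigma>)\<bar>)"
      unfolding cut_embedding_def using \<omega>
      by (intro cSUP_least cut_height_le) (auto simp: space_offset_pairs)
    ultimately show ?thesis by simp
  qed
  then show ?thesis
    by (intro P.integrable_const_bound measurable_cut_embedding AE_I2)
qed

text \<open>The two offsets are independent with the same distribution, so exchanging them preserves
  the product measure.\<close>

lemma measure_separates_swap:
  "measure offset_pairs {\<omega> \<in> space offset_pairs. separates n \<sigma> u v i (prod.swap \<omega>)} =
   measure offset_pairs {\<omega> \<in> space offset_pairs. separates n \<sigma> u v i \<omega>}" (is "_ = measure _ ?X")
proof -
  interpret U: prob_space offset_measure by (rule prob_space_offset_measure)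
  interpret UU: pair_prob_space offset_measure offset_measure ..
  have "Measurable.pred offset_pairs (\<lambda>\<omega>. separates n \<sigma> u v i (fst \<omega>, snd \<omega>))" by measurable
  then have X: "?X \<in> sets offset_pairs" by simp
  have "measure offset_pairs ?X =
      measure (distr offset_pairs offset_pairs (\<lambda>(x, y). (y, x))) ?X"
    using UU.distr_pair_swap by simp
  also have "\<dots> = measure offset_pairs ((\<lambda>(x, y). (y, x)) -` ?X \<inter> space offset_pairs)"
    using X by (subst measure_distr) auto
  also have "(\<lambda>(x, y). (y, x)) -` ?X \<inter> space offset_pairs =
      {\<omega> \<in> space offset_pairs. separates n \<sigma> u v i (prod.swap \<omega>)}"
    by (auto simp: space_offset_pairs)
  finally show ?thesis by simp
qed

text \<open>Scales up to \<open>v - u\<close> cost at most \<open>4 * (v - u)\<close> together,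
  since only the largest height counts. Of the larger scales, \<open>O(log n)\<close> lie below the
  crowding threshold and cost \<open>O(v - u)\<close> each; the crowding terms of all scales add
  only \<open>O(v - u)\<close> in total.\<close>

lemma expectation_cut_embedding:
  assumes uv: "u \<in> fst ` set \<sigma>" "v \<in> fst ` set \<sigma>" "u < v" and n: "card (fst ` set \<sigma>) \<le> n"
  shows "(\<integral>\<omega>. cut_embedding n \<omega> \<sigma> u v \<partial>offset_pairs) \<le> (164 + 64 * log 2 n) * (v - u)"
proof -
  interpret P: prob_space offset_pairs by (rule prob_space_offset_pairs)
  define L where "L = v - u"
  have L: "0 < L" unfolding L_def using uv by simp
  define S where "S = fst ` set \<sigma>"
  have finS: "finite S" unfolding S_def by simp
  have n1: "1 \<le> n" using n uv(1) finS unfolding S_def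
    by (metis card_gt_0_iff empty_iff le_trans less_one linorder_not_le)
  obtain i :: int where i: "2 powi i \<le> L" "L < 2 * 2 powi i" using dyadic_scale[OF L] by blast
  \<comment> \<open>The first dyadic scale exceeding \<open>L\<close>; larger scales are indexed
    from here by \<open>j\<close>.\<close>
  define t :: real where "t = 2 powi (i + 1)"
  have t: "L \<le> t" "0 < t" unfolding t_def using i by (auto simp: power_int_add)
  have scale: "2 powi (i + 1 + int j) = t * 2 ^ j" for j unfolding t_def by (simp add: power_int_add)
  define R where "R = 4 * (\<bar>u - fst (hd \<sigma>)\<bar> + \<bar>v - fst (hd \<sigma>)\<bar>)"
  obtain J where J: "R / t < 2 ^ J" using real_arch_pow[of 2 "R / t"] by auto
  define X where "X j = {\<omega> \<in> space offset_pairs. separates n \<sigma> u v (i + 1 + int j) \<omega>}" for j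
  define Y where "Y j = {\<omega> \<in> space offset_pairs. separates n \<sigma> u v (i + 1 + int j) (prod.swap \<omega>)}" for j
  have "Measurable.pred offset_pairs (\<lambda>\<omega>. separates n \<sigma> u v (i + 1 + int j) (fst \<omega>, snd \<omega>))" for j
    by measurable
  then have X_sets [measurable]: "X j \<in> sets offset_pairs" for j unfolding X_def by simp
  have "Measurable.pred offset_pairs (\<lambda>\<omega>. separates n \<sigma> u v (i + 1 + int j) (snd \<omega>, fst \<omega>))" for j
    by measurable
  then have Y_sets [measurable]: "Y j \<in> sets offset_pairs" for j
    unfolding Y_def by (simp add: prod.swap_def)
  \<comment> \<open>For scales above \<open>L\<close> the supremum is bounded by the sum;
    \<open>X j\<close> and \<open>Y j\<close> are the events for the two orders of the
    offsets.\<close>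
  define g where "g \<omega> = 4 * L + (\<Sum>j<J. 4 * (t * 2 ^ j) * (indicator (X j) \<omega> + indicator (Y j) \<omega>))"
    for \<omega> :: "real \<times> real"
  have le_g: "cut_embedding n \<omega> \<sigma> u v \<le> g \<omega>" if \<omega>: "\<omega> \<in> space offset_pairs" for \<omega>
    unfolding cut_embedding_def
  proof (rule cSUP_least)
    fix i'
    have mm: "min u v = u" "max u v = v" using uv by auto
    have sum_nn: "0 \<le> (\<Sum>j<J. 4 * (t * 2 ^ j) * (indicator (X j) \<omega> + indicator (Y j) \<omega>))"
      using t by (intro sum_nonneg) (auto simp: indicator_def)
    show "cut_height n \<sigma> (min u v) (max u v) \<omega> i' \<le> g \<omega>"
    proof (cases "separates n \<sigma> u v i' \<omega> \<or> separates n \<sigma> u v i' (prod.swap \<omega>)")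
      case False
      then show ?thesis unfolding mm cut_height_def g_def using L sum_nn by simp
    next
      case True
      then have h: "cut_height n \<sigma> (min u v) (max u v) \<omega> i' = 4 * 2 powi i'"
        unfolding mm cut_height_def by simp
      show ?thesis
      proof (cases "i' \<le> i")
        case True
        then have "(2::real) powi i' \<le> 2 powi i" by (intro power_int_increasing) auto
        then have "4 * 2 powi i' \<le> 4 * L" using i by linarith
        then show ?thesis unfolding h g_def using sum_nn by linarith
      next
        case False
        then have "i' = i + 1 + int (nat (i' - i - 1))" by simp
        then obtain j where j: "i' = i + 1 + int j" by blast
        have "fst \<omega> \<in> offsets" "fst (prod.swap \<omega>) \<in> offsets"
          using \<omega> by (auto simp: space_offset_pairs)
        then have "2 powi i' \<le> R" using separates_scale_le True unfolding R_def by blast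
        then have "2 ^ j \<le> R / t" unfolding j scale using t by (simp add: field_simps)
        then have "(2::real) ^ j < 2 ^ J" using J by linarith
        then have jJ: "j < J" by simp
        have "4 * 2 powi i' \<le> 4 * (t * 2 ^ j) * (indicator (X j) \<omega> + indicator (Y j) \<omega>)"
          using True \<omega> t unfolding j scale X_def Y_def by (auto simp: indicator_def)
        also have "\<dots> \<le> (\<Sum>j<J. 4 * (t * 2 ^ j) * (indicator (X j) \<omega> + indicator (Y j) \<omega>))"
          using jJ t by (intro member_le_sum) (auto simp: indicator_def)
        finally show ?thesis unfolding h g_def using L by linarith
      qed
    qed
  qed simp
  \<comment> \<open>The crowding term of the pair \<open>p\<close>, \<open>q\<close> from
    \<open>prob_separates\<close>, multiplied by the height \<open>4 * (t * 2 ^ j)\<close> and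
    stripped of the common factor \<open>32 * L\<close>.\<close>
  define cr where "cr p q j = (if p < q \<and> q - p \<le> t * 2 ^ j / (real n)\<^sup>2
      then (q - p) / (t * 2 ^ j) else 0)" for p q j
  have Y_X: "measure offset_pairs (Y j) = measure offset_pairs (X j)" for j
    unfolding X_def Y_def by (rule measure_separates_swap)
  have X_le: "4 * (t * 2 ^ j) * measure offset_pairs (X j) \<le>
      16 * L * (if t * 2 ^ j / (real n)\<^sup>2 < L then 1 else 0) +
      32 * L * (\<Sum>p\<in>S. \<Sum>q\<in>S. cr p q j)" for j
  proof -
    define s where "s = t * 2 ^ j"
    have s: "0 < s" unfolding s_def using t by simp
    have "t * 1 \<le> t * 2 ^ j" using t by (intro mult_left_mono) auto
    then have "L \<le> 2 powi (i + 1 + int j)" unfolding scale using t by linarith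
    from prob_separates[OF uv this[unfolded L_def], of n, unfolded scale]
    have "measure offset_pairs (X j) \<le> (if s / (real n)\<^sup>2 < L then 4 * L / s else 0) +
      (\<Sum>p\<in>S. \<Sum>q\<in>S. if p < q \<and> q - p \<le> s / (real n)\<^sup>2 then 8 * L * (q - p) / s\<^sup>2 else 0)"
      unfolding X_def S_def L_def s_def by simp
    then have "4 * s * measure offset_pairs (X j) \<le> 4 * s * \<dots>"
      using s by (intro mult_left_mono) auto
    also have "\<dots> = 16 * L * (if s / (real n)\<^sup>2 < L then 1 else 0) +
      32 * L * (\<Sum>p\<in>S. \<Sum>q\<in>S. cr p q j)"
      using s unfolding cr_def s_def[symmetric] distrib_left sum_distrib_left
      by (intro arg_cong2[of _ _ _ _ "(+)"] sum.cong) (auto simp: field_simps power2_eq_square)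
    finally show ?thesis unfolding s_def .
  qed
  have cr_sum: "(\<Sum>j<J. cr p q j) \<le> 2 / (real n)\<^sup>2" for p q
  proof (cases "p < q")
    case True
    have "cr p q j = (if (q - p) * (real n)\<^sup>2 \<le> t * 2 ^ j then (q - p) / (t * 2 ^ j) else 0)" for j
      unfolding cr_def using True n1 by (simp add: field_simps)
    then show ?thesis using sum_geometric_tail_le[of "q - p" t "(real n)\<^sup>2" J] True t n1 by simp
  next
    case False
    then show ?thesis unfolding cr_def by simp
  qed
  \<comment> \<open>Summing over scales first leaves at most \<open>2 / n^2\<close> per pair, which
    the at most \<open>n^2\<close> pairs turn into 2. This balance dictates the threshold
    \<open>2 powi i / n^2\<close>.\<close>
  have "(\<Sum>j<J. \<Sum>p\<in>S. \<Sum>q\<in>S. cr p q j) = (\<Sum>p\<in>S. \<Sum>q\<in>S. \<Sum>j<J. cr p q j)"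
    by (subst sum.swap, intro sum.cong refl, subst sum.swap) simp
  also have "\<dots> \<le> (\<Sum>p\<in>S. \<Sum>q\<in>S. 2 / (real n)\<^sup>2)" by (intro sum_mono cr_sum)
  also have "\<dots> = (real (card S))\<^sup>2 * (2 / (real n)\<^sup>2)" by (simp add: power2_eq_square)
  also have "\<dots> \<le> (real n)\<^sup>2 * (2 / (real n)\<^sup>2)"
    using n unfolding S_def by (intro mult_right_mono power_mono) auto
  also have "\<dots> = 2" using n1 by simp
  finally have crowd: "(\<Sum>j<J. \<Sum>p\<in>S. \<Sum>q\<in>S. cr p q j) \<le> 2" .
  have int_g: "integrable offset_pairs g"
    unfolding g_def by (simp add: P.emeasure_eq_measure)
  have "(\<integral>\<omega>. cut_embedding n \<omega> \<sigma> u v \<partial>offset_pairs) \<le> (\<integral>\<omega>. g \<omega> \<partial>offset_pairs)"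
    by (intro integral_mono integrable_cut_embedding int_g le_g)
  also have "\<dots> = 4 * L + (\<Sum>j<J. 4 * (t * 2 ^ j) * (measure offset_pairs (X j) + measure offset_pairs (Y j)))"
    unfolding g_def
    by (simp add: P.emeasure_eq_measure P.prob_space)
  also have "\<dots> = 4 * L + 2 * (\<Sum>j<J. 4 * (t * 2 ^ j) * measure offset_pairs (X j))"
    unfolding Y_X sum_distrib_left by (simp add: algebra_simps)
  also have "\<dots> \<le> 4 * L + 2 * (\<Sum>j<J. 16 * L * (if t * 2 ^ j / (real n)\<^sup>2 < L then 1 else 0) +
      32 * L * (\<Sum>p\<in>S. \<Sum>q\<in>S. cr p q j))"
    by (intro add_left_mono mult_left_mono sum_mono X_le) auto
  also have "\<dots> = 4 * L + 32 * L * (\<Sum>j<J. if t * 2 ^ j / (real n)\<^sup>2 < L then 1 else 0) +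
      64 * L * (\<Sum>j<J. \<Sum>p\<in>S. \<Sum>q\<in>S. cr p q j)"
    by (simp add: sum.distrib sum_distrib_left[symmetric] algebra_simps)
  \<comment> \<open>The constants combine as 4 + 32 + 128 = 164 and 32 times 2 = 64.\<close>
  also have "\<dots> \<le> 4 * L + 32 * L * (2 * log 2 n + 1) + 64 * L * 2"
    using L crowd count_scales_le[OF n1 L t(1), of J] by (intro add_mono mult_left_mono) auto
  also have "\<dots> = (164 + 64 * log 2 n) * (v - u)" unfolding L_def by (simp add: algebra_simps)
  finally show ?thesis .
qed

section \<open>The distribution on embeddings\<close>

text \<open>The image carries the largest sigma-algebra that makes \<open>F\<close> measurable, so
  \<open>h\<close> is measurable as soon as its composition with \<open>F\<close> is. With the image
  as carrier, every outcome has the form \<open>F x\<close>.\<close>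

lemma pushforward_onto_range:
  fixes F :: "'a \<Rightarrow> 'b"
  assumes "prob_space P"
  obtains M where "prob_space M" "space M = F ` space P"
    "\<And>h :: 'b \<Rightarrow> real. integrable P (\<lambda>x. h (F x)) \<Longrightarrow>
       integrable M h \<and> (\<integral>y. h y \<partial>M) = (\<integral>x. h (F x) \<partial>P)"
proof -
  interpret P: prob_space P by fact
  define G where "G = {A. A \<subseteq> F ` space P \<and> F -` A \<inter> space P \<in> sets P}"
  define M0 where "M0 = sigma (F ` space P) G"
  have F: "F \<in> measurable P M0" unfolding M0_def G_def by (rule measurable_measure_of) auto
  have h: "h \<in> borel_measurable M0" if "(\<lambda>x. h (F x)) \<in> borel_measurable P" for h :: "'b \<Rightarrow> real"
  proof (rule measurableI)
    fix A :: "real set" assume "A \<in> sets borel"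
    then have "(\<lambda>x. h (F x)) -` A \<inter> space P \<in> sets P" using that by (rule measurable_sets[rotated])
    moreover have "F -` (h -` A \<inter> F ` space P) \<inter> space P = (\<lambda>x. h (F x)) -` A \<inter> space P" by auto
    ultimately have "h -` A \<inter> F ` space P \<in> G" unfolding G_def by auto
    then show "h -` A \<inter> space M0 \<in> sets M0" unfolding M0_def G_def
      by (subst space_measure_of) (auto intro!: in_measure_of)
  qed simp
  show thesis
  proof
    show "prob_space (distr P M0 F)" using F by (rule P.prob_space_distr)
    show "space (distr P M0 F) = F ` space P" unfolding M0_def G_def by (subst space_distr, subst space_measure_of) auto
    fix h :: "'b \<Rightarrow> real" assume i: "integrable P (\<lambda>x. h (F x))"
    then have "h \<in> borel_measurable M0" by (intro h) auto
    then show "integrable (distr P M0 F) h \<and> (\<integral>y. h y \<partial>distr P M0 F) = (\<integral>x. h (F x) \<partial>P)"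
      using i F by (simp add: integrable_distr_eq integral_distr)
  qed
qed

text \<open>From \<open>ln 2 \<ge> 2 / 3\<close> the logarithmic term is at most
  \<open>96 * ln n\<close>, and 164 + 96 = 260 is below 300.\<close>

lemma log2_le_max_ln:
  assumes "1 \<le> n"
  shows "164 + 64 * log 2 (real n) \<le> 300 * max 1 (ln (real n))"
proof -
  have "2 / 3 \<le> ln (2::real)" by (rule ln2_ge_two_thirds)
  then have "ln (real n) * (2 / 3) \<le> ln (real n) * ln 2" using assms by (intro mult_left_mono) auto
  then have "log 2 (real n) \<le> 3 / 2 * ln (real n)" unfolding log_def by (simp add: field_simps)
  then show ?thesis by (simp add: max_def)
qed

theorem mainTheorem17:
  shows "\<exists>C::real. \<forall>n::nat. \<exists>M.
           prob_online_monotone_HST_embedding n M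
         \<and> has_distortion n M (C * max 1 (ln (real n)))"
proof (intro exI[of _ 300] allI)
  fix n :: nat
  obtain M where M: "prob_space M" "space M = cut_embedding n ` space offset_pairs"
    and int_M: "\<And>h :: online_embedding \<Rightarrow> real. integrable offset_pairs (\<lambda>\<omega>. h (cut_embedding n \<omega>)) \<Longrightarrow>
       integrable M h \<and> (\<integral>E. h E \<partial>M) = (\<integral>\<omega>. h (cut_embedding n \<omega>) \<partial>offset_pairs)"
    using pushforward_onto_range[OF prob_space_offset_pairs, of "cut_embedding n"] by blast
  have "prob_online_monotone_HST_embedding n M"
    unfolding prob_online_monotone_HST_embedding_def
    using M cut_embedding_online by (auto intro!: AE_I2 simp: space_offset_pairs)
  moreover have "has_distortion n M (300 * max 1 (ln (real n)))"
    unfolding has_distortion_def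
  proof (intro allI impI ballI conjI)
    fix \<sigma> u v assume n: "num_points \<sigma> \<le> n" and uv: "u \<in> alive \<sigma>" "v \<in> alive \<sigma>"
    note eval = int_M[of "\<lambda>E. E \<sigma> u v", OF integrable_cut_embedding]
    show "integrable M (\<lambda>E. E \<sigma> u v)" using eval by blast
    have card: "card (fst ` set \<sigma>) \<le> n" using n unfolding num_points_def by simp
    have mem: "u \<in> fst ` set \<sigma>" "v \<in> fst ` set \<sigma>" using uv alive_subset by auto
    \<comment> \<open>An alive point forces \<open>n\<close> to be positive; for
      \<open>n = 0\<close> the distortion bound is vacuous.\<close>
    have n1: "1 \<le> n" using card mem(1)
      by (metis List.finite_set card_gt_0_iff empty_iff finite_imageI le_trans less_one linorder_not_le)
    have "(\<integral>\<omega>. cut_embedding n \<omega> \<sigma> u v \<partial>offset_pairs) \<le> (164 + 64 * log 2 n) * \<bar>u - v\<bar>"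
    proof (cases u v rule: linorder_cases)
      case less
      then show ?thesis using expectation_cut_embedding[OF mem less card] by simp
    next
      case equal
      then show ?thesis by (simp add: cut_embedding_self)
    next
      case greater
      then show ?thesis using expectation_cut_embedding[OF mem(2,1) greater card]
        by (simp add: cut_embedding_sym[of n _ \<sigma> u v])
    qed
    also have "\<dots> \<le> 300 * max 1 (ln (real n)) * \<bar>u - v\<bar>"
      by (intro mult_right_mono log2_le_max_ln n1) auto
    finally show "(\<integral>E. E \<sigma> u v \<partial>M) \<le> 300 * max 1 (ln (real n)) * \<bar>u - v\<bar>" using eval by simp
  qed
  ultimately show "\<exists>M. prob_online_monotone_HST_embedding n M
      \<and> has_distortion n M (300 * max 1 (ln (real n)))" by blast
qed

end
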